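(* Let $\mathbb{F}$ be a field with $\operatorname{char}\mathbb{F}\neq 2$, let $n\geq 2$, and let $\mathcal{A}_n$ be a Cayley--Dickson algebra over $\mathbb{F}$ with anisotropic norm. Let $a\in\mathcal{A}_n\setminus\mathbb{F}$ be such that its imaginary part $\mathfrak{Im}(a)$ does not belong to $Z(\mathcal{A}_n)$. Then the connected component of the commutativity graph $\Gamma_C(\mathcal{A}_n)$ which contains (the vertex represented by) $a$ is a singleton.
   Context: Cayley--Dickson algebras: given a unital algebra $\mathcal{A}$ over $\mathbb{F}$ with involution $a\mapsto\bar a$ and $0\neq\gamma\in\mathbb{F}$, the algebra $\mathcal{A}\{\gamma\}$ is the vector space $\mathcal{A}\times\mathcal{A}$ with multiplication $(a,b)(c,d)=(ac+\gamma\bar d b,\; da+b\bar c)$ and involution $\overline{(a,b)}=(\bar a,-b)$. For nonzero $\gamma_0,\dots,\gamma_{n-1}\in\mathbb{F}$, the Cayley--Dickson algebra $\mathcal{A}_n=\mathcal{A}_n\{\gamma_0,\dots,\gamma_{n-1}\}$ is defined inductively by $\mathcal{A}_0=\mathbb{F}$ (with trivial involution) and $\mathcal{A}_{k+1}=\mathcal{A}_k\{\gamma_k\}$. It is a unital $2^n$-dimensional algebra; $\mathbb{F}$ is identified with the multiples of the unity. For $a\in\mathcal{A}_n$: $\mathfrak{Im}(a)=\frac{a-\bar a}{2}$ and the norm is $n(a)=a\bar a=\bar a a\in\mathbb{F}$. The norm is anisotropic if $n(a)=0$ only for $a=0$. $Z(\mathcal{A}_n)$ is the set of zero divisors (left,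 right, or two-sided) of $\mathcal{A}_n$, i.e. nonzero $a$ for which there is a nonzero $b$ with $ab=0$ or $ba=0$. $C_{\mathcal{A}_n}$ denotes the commutative center of $\mathcal{A}_n$, i.e. the set of elements commuting with all elements of $\mathcal{A}_n$; for $n\ge 2$ one has $C_{\mathcal{A}_n}=\mathbb{F}$. The commutativity graph $\Gamma_C(\mathcal{A}_n)$ is the undirected graph without loops whose vertices are $\mathbb{F}a+C_{\mathcal{A}_n}$ for $a\in\mathcal{A}_n\setminus C_{\mathcal{A}_n}$ (lines in $\mathcal{A}_n/C_{\mathcal{A}_n}$), where distinct vertices $\mathbb{F}a+C_{\mathcal{A}_n}$ and $\mathbb{F}b+C_{\mathcal{A}_n}$ are adjacent if and only if $ab=ba$. An element $a$ is identified with the vertex $\mathbb{F}a+C_{\mathcal{A}_n}$. *)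

theory Defs
  imports Main
begin

(* An element of the n-th Cayley-Dickson algebra over 'a is a perfect binary tree of depth n with
   leaves in 'a: Scal embeds the ground field A_0, and Dbl a b is the pair (a, b) in A_{k+1} = A_k x A_k.
   Dependence on n is thus a matter of carrier sets, not of types.  The binary operations are
   unspecified on trees of different shapes. *)
datatype 'a cd = Scal 'a | Dbl "'a cd" "'a cd"

primrec cd_carrier :: "nat \<Rightarrow> 'a cd set" where
  "cd_carrier 0 = range Scal"
| "cd_carrier (Suc k) = {Dbl a b | a b. a \<in> cd_carrier k \<and> b \<in> cd_carrier k}"

fun cd_add :: "'a::field cd \<Rightarrow> 'a cd \<Rightarrow> 'a cd" where
  "cd_add (Scal x) (Scal y) = Scal (x + y)"
| "cd_add (Dbl a b) (Dbl c d) = Dbl (cd_add a c) (cd_add b d)"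

primrec cd_smult :: "'a::field \<Rightarrow> 'a cd \<Rightarrow> 'a cd" where
  "cd_smult r (Scal x) = Scal (r * x)"
| "cd_smult r (Dbl a b) = Dbl (cd_smult r a) (cd_smult r b)"

definition cd_uminus :: "'a::field cd \<Rightarrow> 'a cd" where
  "cd_uminus a = cd_smult (-1) a"

definition cd_diff :: "'a::field cd \<Rightarrow> 'a cd \<Rightarrow> 'a cd" where
  "cd_diff a b = cd_add a (cd_uminus b)"

primrec cd_zero :: "nat \<Rightarrow> 'a::field cd" where
  "cd_zero 0 = Scal 0"
| "cd_zero (Suc k) = Dbl (cd_zero k) (cd_zero k)"

primrec cd_one :: "nat \<Rightarrow> 'a::field cd" where
  "cd_one 0 = Scal 1"
| "cd_one (Suc k) = Dbl (cd_one k) (cd_zero k)"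

primrec cd_cnj :: "'a::field cd \<Rightarrow> 'a cd" where
  "cd_cnj (Scal x) = Scal x"
| "cd_cnj (Dbl a b) = Dbl (cd_cnj a) (cd_uminus b)"

(* (a,b)(c,d) = (ac + g (cnj d) b, da + b (cnj c)); only g 0, ..., g (n-1) matter at level n. *)
fun cd_mult :: "(nat \<Rightarrow> 'a::field) \<Rightarrow> nat \<Rightarrow> 'a cd \<Rightarrow> 'a cd \<Rightarrow> 'a cd" where
  "cd_mult g 0 (Scal x) (Scal y) = Scal (x * y)"
| "cd_mult g (Suc k) (Dbl a b) (Dbl c d) =
     Dbl (cd_add (cd_mult g k a c) (cd_smult (g k) (cd_mult g k (cd_cnj d) b)))
         (cd_add (cd_mult g k d a) (cd_mult g k b (cd_cnj c)))"

(* The ground field inside A_n. *)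
definition cd_scalars :: "nat \<Rightarrow> 'a::field cd set" where
  "cd_scalars n = {cd_smult r (cd_one n) | r. True}"

definition cd_Im :: "'a::field cd \<Rightarrow> 'a cd" where
  "cd_Im a = cd_smult (1 / 2) (cd_diff a (cd_cnj a))"

(* The norm takes values in cd_scalars n, see cd_norm_scalar below. *)
definition cd_norm :: "(nat \<Rightarrow> 'a::field) \<Rightarrow> nat \<Rightarrow> 'a cd \<Rightarrow> 'a cd" where
  "cd_norm g n a = cd_mult g n a (cd_cnj a)"

definition cd_anisotropic :: "(nat \<Rightarrow> 'a::field) \<Rightarrow> nat \<Rightarrow> bool" where
  "cd_anisotropic g n \<longleftrightarrow> (\<forall>a \<in> cd_carrier n. cd_norm g n a = cd_zero n \<longrightarrow> a = cd_zero n)"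

definition cd_zero_divisors :: "(nat \<Rightarrow> 'a::field) \<Rightarrow> nat \<Rightarrow> 'a cd set" where
  "cd_zero_divisors g n =
     {a \<in> cd_carrier n. a \<noteq> cd_zero n \<and>
        (\<exists>b \<in> cd_carrier n. b \<noteq> cd_zero n \<and>
           (cd_mult g n a b = cd_zero n \<or> cd_mult g n b a = cd_zero n))}"

definition cd_center :: "(nat \<Rightarrow> 'a::field) \<Rightarrow> nat \<Rightarrow> 'a cd set" where
  "cd_center g n = {a \<in> cd_carrier n. \<forall>b \<in> cd_carrier n. cd_mult g n a b = cd_mult g n b a}"

(* F a + C, as a set of elements. *)
definition cd_vertex :: "(nat \<Rightarrow> 'a::field) \<Rightarrow> nat \<Rightarrow> 'a cd \<Rightarrow> 'a cd set" where
  "cd_vertex g n a = {cd_add (cd_smult r a) z | r z. z \<in> cd_center g n}"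

definition comm_graph_verts :: "(nat \<Rightarrow> 'a::field) \<Rightarrow> nat \<Rightarrow> 'a cd set set" where
  "comm_graph_verts g n = cd_vertex g n ` (cd_carrier n - cd_center g n)"

(* Adjacency does not depend on the chosen representatives, see comm_graph_adj_iff below. *)
definition comm_graph_adj :: "(nat \<Rightarrow> 'a::field) \<Rightarrow> nat \<Rightarrow> 'a cd set \<Rightarrow> 'a cd set \<Rightarrow> bool" where
  "comm_graph_adj g n V W \<longleftrightarrow> V \<noteq> W \<and>
     (\<exists>a \<in> cd_carrier n - cd_center g n. \<exists>b \<in> cd_carrier n - cd_center g n.
        V = cd_vertex g n a \<and> W = cd_vertex g n b \<and> cd_mult g n a b = cd_mult g n b a)"

definition graph_component :: "'v set \<Rightarrow> ('v \<Rightarrow> 'v \<Rightarrow> bool) \<Rightarrow> 'v \<Rightarrow> 'v set" where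
  "graph_component V adj v = {w \<in> V. (v, w) \<in> {(x, y). x \<in> V \<and> y \<in> V \<and> adj x y}\<^sup>*}"


lemma cd_carrier_Suc_iff [simp]:
  "Dbl a b \<in> cd_carrier (Suc k) \<longleftrightarrow> a \<in> cd_carrier k \<and> b \<in> cd_carrier k"
  "Scal x \<notin> cd_carrier (Suc k)"
  by auto

declare cd_carrier.simps(2) [simp del]

lemma cd_carrier_SucE:
  assumes "x \<in> cd_carrier (Suc k)"
  obtains a b where "x = Dbl a b" "a \<in> cd_carrier k" "b \<in> cd_carrier k"
  using assms by (auto simp: cd_carrier.simps(2))

lemma cd_closed_linear [simp]:
  "x \<in> cd_carrier n \<Longrightarrow> cd_smult r x \<in> cd_carrier n"
  "x \<in> cd_carrier n \<Longrightarrow> y \<in> cd_carrier n \<Longrightarrow> cd_add x y \<in> cd_carrier n"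
  "cd_zero n \<in> cd_carrier n"
  by (induction n arbitrary: x y) (auto elim!: cd_carrier_SucE)

lemma cd_uminus_closed [simp]: "x \<in> cd_carrier n \<Longrightarrow> cd_uminus x \<in> cd_carrier n"
  by (simp add: cd_uminus_def)

lemma cd_cnj_closed [simp]: "x \<in> cd_carrier n \<Longrightarrow> cd_cnj x \<in> cd_carrier n"
  by (induction n arbitrary: x) (auto elim!: cd_carrier_SucE)

lemma cd_one_closed [simp]: "cd_one n \<in> cd_carrier n"
  by (induction n) auto

lemma cd_mult_closed [simp]:
  "x \<in> cd_carrier n \<Longrightarrow> y \<in> cd_carrier n \<Longrightarrow> cd_mult g n x y \<in> cd_carrier n"
  by (induction n arbitrary: x y) (auto elim!: cd_carrier_SucE)

lemma cd_add_assoc: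
  "x \<in> cd_carrier n \<Longrightarrow> y \<in> cd_carrier n \<Longrightarrow> z \<in> cd_carrier n \<Longrightarrow>
   cd_add (cd_add x y) z = cd_add x (cd_add y z)"
  by (induction n arbitrary: x y z) (auto elim!: cd_carrier_SucE simp: algebra_simps)

lemma cd_add_comm:
  "x \<in> cd_carrier n \<Longrightarrow> y \<in> cd_carrier n \<Longrightarrow> cd_add x y = cd_add y x"
  by (induction n arbitrary: x y) (auto elim!: cd_carrier_SucE simp: algebra_simps)

lemma cd_add_left_comm:
  "x \<in> cd_carrier n \<Longrightarrow> y \<in> cd_carrier n \<Longrightarrow> z \<in> cd_carrier n \<Longrightarrow>
   cd_add x (cd_add y z) = cd_add y (cd_add x z)"
  by (metis cd_add_assoc cd_add_comm)

lemma cd_add_zero [simp]: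
  "x \<in> cd_carrier n \<Longrightarrow> cd_add x (cd_zero n) = x"
  "x \<in> cd_carrier n \<Longrightarrow> cd_add (cd_zero n) x = x"
  by (induction n arbitrary: x) (auto elim!: cd_carrier_SucE)

lemma cd_add_left_cancel:
  "x \<in> cd_carrier n \<Longrightarrow> y \<in> cd_carrier n \<Longrightarrow> z \<in> cd_carrier n \<Longrightarrow>
   cd_add x y = cd_add x z \<longleftrightarrow> y = z"
  by (induction n arbitrary: x y z) (auto elim!: cd_carrier_SucE)

lemma cd_smult_smult [simp]: "cd_smult r (cd_smult s x) = cd_smult (r * s) x"
  by (induction x) (auto simp: algebra_simps)

lemma cd_smult_one [simp]: "cd_smult 1 x = x"
  by (induction x) auto

lemma cd_smult_zero [simp]:
  "cd_smult r (cd_zero n) = cd_zero n"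
  "x \<in> cd_carrier n \<Longrightarrow> cd_smult 0 x = cd_zero n"
  by (induction n arbitrary: x) (auto elim!: cd_carrier_SucE)

lemma cd_smult_add_right:
  "x \<in> cd_carrier n \<Longrightarrow> y \<in> cd_carrier n \<Longrightarrow>
   cd_smult r (cd_add x y) = cd_add (cd_smult r x) (cd_smult r y)"
  by (induction n arbitrary: x y) (auto elim!: cd_carrier_SucE simp: algebra_simps)

lemma cd_smult_add_left:
  "cd_smult (r + s) x = cd_add (cd_smult r x) (cd_smult s x)"
  by (induction x) (auto simp: algebra_simps)

lemma cd_cnj_smult: "cd_cnj (cd_smult r x) = cd_smult r (cd_cnj x)"
  by (induction x) (auto simp: cd_uminus_def mult.commute)

lemma cd_cnj_add:
  "x \<in> cd_carrier n \<Longrightarrow> y \<in> cd_carrier n \<Longrightarrow> cd_cnj (cd_add x y) = cd_add (cd_cnj x) (cd_cnj y)"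
  by (induction n arbitrary: x y)
    (auto elim!: cd_carrier_SucE simp: cd_uminus_def cd_smult_add_right)

lemma cd_cnj_zero: "cd_cnj (cd_zero n) = cd_zero n"
  by (induction n) (auto simp: cd_uminus_def)

lemma cd_cnj_cnj [simp]: "cd_cnj (cd_cnj x) = x"
  by (induction x) (auto simp: cd_uminus_def)

lemma cd_mult_smult:
  assumes "x \<in> cd_carrier n" "y \<in> cd_carrier n"
  shows "cd_mult g n (cd_smult r x) y = cd_smult r (cd_mult g n x y)"
    and "cd_mult g n x (cd_smult r y) = cd_smult r (cd_mult g n x y)"
proof -
  have "cd_mult g n (cd_smult r x) y = cd_smult r (cd_mult g n x y) \<and>
        cd_mult g n x (cd_smult r y) = cd_smult r (cd_mult g n x y)"
    using assms
  proof (induction n arbitrary: x y)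
    case 0
    then show ?case by (auto simp: algebra_simps)
  next
    case (Suc n)
    from Suc.prems show ?case
      by (elim cd_carrier_SucE)
        (simp add: Suc.IH cd_cnj_smult cd_smult_add_right[where n = n] mult.commute)
  qed
  then show "cd_mult g n (cd_smult r x) y = cd_smult r (cd_mult g n x y)"
    and "cd_mult g n x (cd_smult r y) = cd_smult r (cd_mult g n x y)" by auto
qed

lemma cd_mult_add:
  assumes "x \<in> cd_carrier n" "y \<in> cd_carrier n" "z \<in> cd_carrier n"
  shows "cd_mult g n (cd_add x y) z = cd_add (cd_mult g n x z) (cd_mult g n y z)"
    and "cd_mult g n z (cd_add x y) = cd_add (cd_mult g n z x) (cd_mult g n z y)"
proof -
  have "cd_mult g n (cd_add x y) z = cd_add (cd_mult g n x z) (cd_mult g n y z) \<and>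
        cd_mult g n z (cd_add x y) = cd_add (cd_mult g n z x) (cd_mult g n z y)"
    using assms
  proof (induction n arbitrary: x y z)
    case 0
    then show ?case by (auto simp: algebra_simps)
  next
    case (Suc n)
    from Suc.prems show ?case
      by (elim cd_carrier_SucE)
        (simp add: Suc.IH cd_cnj_add[where n = n] cd_smult_add_right[where n = n]
          cd_add_assoc[where n = n] cd_add_comm[where n = n] cd_add_left_comm[where n = n])
  qed
  then show "cd_mult g n (cd_add x y) z = cd_add (cd_mult g n x z) (cd_mult g n y z)"
    and "cd_mult g n z (cd_add x y) = cd_add (cd_mult g n z x) (cd_mult g n z y)" by auto
qed

lemma cd_mult_zero:
  assumes "x \<in> cd_carrier n"
  shows "cd_mult g n x (cd_zero n) = cd_zero n" and "cd_mult g n (cd_zero n) x = cd_zero n"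
proof -
  show "cd_mult g n x (cd_zero n) = cd_zero n"
    using cd_mult_smult(2)[of x n "cd_zero n" g 0] assms by (metis cd_closed_linear(3) cd_mult_closed cd_smult_zero)
  show "cd_mult g n (cd_zero n) x = cd_zero n"
    using cd_mult_smult(1)[of "cd_zero n" n x g 0] assms by (metis cd_closed_linear(3) cd_mult_closed cd_smult_zero)
qed

lemma cd_mult_one:
  assumes "x \<in> cd_carrier n"
  shows "cd_mult g n x (cd_one n) = x" and "cd_mult g n (cd_one n) x = x"
proof -
  have c: "cd_cnj (cd_one m :: 'a cd) = cd_one m" for m
    by (induction m) (auto simp: cd_uminus_def)
  have "cd_mult g n x (cd_one n) = x \<and> cd_mult g n (cd_one n) x = x"
    using assms
    by (induction n arbitrary: x)
      (auto elim!: cd_carrier_SucE simp: c cd_mult_zero cd_cnj_zero)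
  then show "cd_mult g n x (cd_one n) = x" and "cd_mult g n (cd_one n) x = x" by auto
qed

lemma cd_norm_scalar:
  assumes "x \<in> cd_carrier n"
  shows "cd_norm g n x \<in> cd_scalars n" and "cd_mult g n (cd_cnj x) x = cd_norm g n x"
proof -
  have "\<exists>r. cd_mult g n x (cd_cnj x) = cd_smult r (cd_one n) \<and>
            cd_mult g n (cd_cnj x) x = cd_smult r (cd_one n)"
    using assms
  proof (induction n arbitrary: x)
    case 0
    then obtain t where "x = Scal t" by auto
    then show ?case by (auto intro!: exI[of _ "t * t"])
  next
    case (Suc n)
    obtain a b where x: "x = Dbl a b" and ab: "a \<in> cd_carrier n" "b \<in> cd_carrier n"
      using Suc.prems by (rule cd_carrier_SucE)
    obtain r where r: "cd_mult g n a (cd_cnj a) = cd_smult r (cd_one n)"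
      "cd_mult g n (cd_cnj a) a = cd_smult r (cd_one n)"
      using Suc.IH[OF ab(1)] by auto
    obtain s where s: "cd_mult g n b (cd_cnj b) = cd_smult s (cd_one n)"
      "cd_mult g n (cd_cnj b) b = cd_smult s (cd_one n)"
      using Suc.IH[OF ab(2)] by auto
    have z: "cd_add y (cd_smult (-1) y) = cd_zero n" "cd_add (cd_smult (-1) y) y = cd_zero n"
      if "y \<in> cd_carrier n" for y :: "'a cd"
      using that cd_smult_add_left[of 1 "-1" y] cd_smult_add_left[of "-1" 1 y] by auto
    show ?case
      using ab by (intro exI[of _ "r - g n * s"])
        (simp add: x r s z cd_uminus_def cd_cnj_smult cd_mult_smult
          cd_smult_add_left[of r "- (g n * s)", simplified])
  qed
  then show "cd_norm g n x \<in> cd_scalars n" and "cd_mult g n (cd_cnj x) x = cd_norm g n x"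
    by (auto simp: cd_norm_def cd_scalars_def)
qed

lemma cd_center_zero: "cd_zero n \<in> cd_center g n"
  by (auto simp: cd_center_def cd_mult_zero)

lemma cd_vertex_memI: "a \<in> cd_carrier n \<Longrightarrow> a \<in> cd_vertex g n a"
  unfolding cd_vertex_def
  by (auto intro!: exI[of _ 1] exI[of _ "cd_zero n"] simp: cd_center_zero)

lemma cd_commute_vertex:
  assumes "a \<in> cd_carrier n" "b \<in> cd_carrier n" "a' \<in> cd_vertex g n a"
    and "cd_mult g n a b = cd_mult g n b a"
  shows "cd_mult g n a' b = cd_mult g n b a'"
proof -
  obtain r z where a': "a' = cd_add (cd_smult r a) z" and z: "z \<in> cd_center g n"
    using assms(3) by (auto simp: cd_vertex_def)
  then have "z \<in> cd_carrier n" "cd_mult g n z b = cd_mult g n b z"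
    using assms(2) by (auto simp: cd_center_def)
  then show ?thesis
    using assms by (simp add: a' cd_mult_add cd_mult_smult)
qed

lemma comm_graph_adj_iff:
  assumes "a \<in> cd_carrier n - cd_center g n" "b \<in> cd_carrier n - cd_center g n"
  shows "comm_graph_adj g n (cd_vertex g n a) (cd_vertex g n b) \<longleftrightarrow>
           cd_vertex g n a \<noteq> cd_vertex g n b \<and> cd_mult g n a b = cd_mult g n b a"
proof
  assume "comm_graph_adj g n (cd_vertex g n a) (cd_vertex g n b)"
  then obtain a' b' where h: "cd_vertex g n a \<noteq> cd_vertex g n b" "a' \<in> cd_carrier n" "b' \<in> cd_carrier n"
    "cd_vertex g n a = cd_vertex g n a'" "cd_vertex g n b = cd_vertex g n b'"
    "cd_mult g n a' b' = cd_mult g n b' a'"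
    unfolding comm_graph_adj_def by (metis DiffD1)
  have "a \<in> cd_vertex g n a'" "b \<in> cd_vertex g n b'"
    using assms cd_vertex_memI h(4,5) by blast+
  then have "cd_mult g n a b' = cd_mult g n b' a"
    using cd_commute_vertex h by blast
  then have "cd_mult g n a b = cd_mult g n b a"
    using cd_commute_vertex[of b' n a b g] assms h \<open>b \<in> cd_vertex g n b'\<close> by auto
  with h show "cd_vertex g n a \<noteq> cd_vertex g n b \<and> cd_mult g n a b = cd_mult g n b a" by simp
next
  assume "cd_vertex g n a \<noteq> cd_vertex g n b \<and> cd_mult g n a b = cd_mult g n b a"
  then show "comm_graph_adj g n (cd_vertex g n a) (cd_vertex g n b)"
    using assms by (auto simp: comm_graph_adj_def)
qed

end

theory Submission
  imports Defs
begin

text \<open>Let \<open>p\<close> and \<open>q\<close> be commuting imaginary elements, \<open>p\<close> nonzero and not a zero divisor.  Then \<open>p q\<close> and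
  \<open>p p\<close> are fixed by the involution, hence scalars, and \<open>p p\<close> is nonzero.  So some \<open>q - \<mu> p\<close> is annihilated by \<open>p\<close>
  and therefore vanishes.  Applied to the imaginary parts of \<open>a\<close> and of an element \<open>b\<close> commuting with \<open>a\<close>,
  this puts \<open>b\<close> into \<open>F a + F\<close>.\<close>

section \<open>Characteristic and linear structure\<close>

lemma two_neq_zero_if_CHAR_neq_2:
  assumes "CHAR('f::field) \<noteq> 2"
  shows "(2::'f) \<noteq> 0"
proof
  assume "(2::'f) = 0"
  then have "of_nat 2 = (0::'f)" by simp
  then have "CHAR('f) dvd 2" by (simp only: of_nat_eq_0_iff_char_dvd)
  then have "CHAR('f) \<le> 2" "CHAR('f) \<noteq> 0" using dvd_imp_le[of "CHAR('f)" 2] by (auto intro: Nat.gr0I)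
  moreover have "CHAR('f) \<noteq> 1" by simp
  ultimately show False using assms by linarith
qed

lemma cd_add_uminus_right [simp]: "x \<in> cd_carrier n \<Longrightarrow> cd_add x (cd_smult (-1) x) = cd_zero n"
  by (induction n arbitrary: x) (auto elim!: cd_carrier_SucE)

lemma cd_add_uminus_cancel:
  assumes "x \<in> cd_carrier n" "z \<in> cd_carrier n"
  shows "cd_add (cd_add x z) (cd_smult (-1) z) = x"
  using assms by (simp add: cd_add_assoc[where n = n])

lemma cd_smult_one_eq_zero_iff: "cd_smult r (cd_one n) = cd_zero n \<longleftrightarrow> r = 0"
  by (induction n) auto

lemma cd_smult_left_cancel: "r \<noteq> 0 \<Longrightarrow> cd_smult r x = cd_smult r y \<longleftrightarrow> x = y"
  by (metis cd_smult_one cd_smult_smult left_inverse)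

lemma cd_cnj_one [simp]: "cd_cnj (cd_one n) = cd_one n"
  by (induction n) (auto simp: cd_uminus_def)

section \<open>The involution and its fixed points\<close>

text \<open>In the first component the inductive hypothesis reverses both products and the signs of
  the second entries cancel; in the second component both sides are the same two products,
  negated.\<close>

lemma cd_cnj_mult:
  assumes "x \<in> cd_carrier n" "y \<in> cd_carrier n"
  shows "cd_cnj (cd_mult g n x y) = cd_mult g n (cd_cnj y) (cd_cnj x)"
  using assms
proof (induction n arbitrary: x y)
  case 0
  then show ?case by (auto simp: mult.commute)
next
  case (Suc n)
  from Suc.prems show ?case
    by (elim cd_carrier_SucE)
      (simp add: Suc.IH cd_uminus_def cd_cnj_add[where n = n] cd_cnj_smult cd_mult_smult
        cd_smult_add_right[where n = n] cd_add_comm[where n = n])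
qed

lemma cd_uminus_eq_self_imp_zero:
  assumes "(2::'f::field) \<noteq> 0" "x \<in> cd_carrier n" "cd_uminus x = (x :: 'f cd)"
  shows "x = cd_zero n"
  using assms(2,3)
proof (induction n arbitrary: x)
  case 0
  then obtain t where "x = Scal t" "- t = t" by (auto simp: cd_uminus_def)
  then have "2 * t = 0" by (metis add.right_inverse mult_2)
  with assms(1) \<open>x = Scal t\<close> show ?case by simp
next
  case (Suc n)
  obtain a b where x: "x = Dbl a b" and ab: "a \<in> cd_carrier n" "b \<in> cd_carrier n"
    using Suc.prems(1) by (rule cd_carrier_SucE)
  then have "cd_uminus a = a" "cd_uminus b = b"
    using Suc.prems(2) by (simp_all add: cd_uminus_def)
  then show ?case using Suc.IH[OF ab(1)] Suc.IH[OF ab(2)] x by simp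
qed

text \<open>The involution negates the second component of a pair, so a fixed pair has second
  component zero, and the first component is fixed again.\<close>

lemma cd_cnj_eq_self_imp_scalar:
  assumes "(2::'f::field) \<noteq> 0" "x \<in> cd_carrier n" "cd_cnj x = (x :: 'f cd)"
  obtains r where "x = cd_smult r (cd_one n)"
proof -
  have "\<exists>r. x = cd_smult r (cd_one n)"
    using assms(2,3)
  proof (induction n arbitrary: x)
    case 0
    then show ?case by auto
  next
    case (Suc n)
    obtain a b where x: "x = Dbl a b" and ab: "a \<in> cd_carrier n" "b \<in> cd_carrier n"
      using Suc.prems(1) by (rule cd_carrier_SucE)
    with Suc show ?case
      using cd_uminus_eq_self_imp_zero[OF assms(1) ab(2)] by auto
  qed
  with that show thesis by blast
qed

section \<open>The commutative center\<close>

lemma cd_scalar_in_center: "cd_smult r (cd_one n) \<in> cd_center g n"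
  by (simp add: cd_center_def cd_mult_smult cd_mult_one)

text \<open>Commuting with \<open>(0, 1)\<close> makes both components of a central element scalar; commuting with \<open>((0, 1), 0)\<close>
  then kills the second component.\<close>
lemma cd_center_scalar:
  fixes g :: "nat \<Rightarrow> 'f::field"
  assumes "(2::'f) \<noteq> 0" "n \<ge> 2" "\<forall>i<n. g i \<noteq> 0" "x \<in> cd_center g n"
  shows "x \<in> cd_scalars n"
proof -
  \<comment> \<open>Two doublings are split off, so that the components of \<open>x\<close> lie in
    an algebra that itself contains an element \<open>(0, 1)\<close>.\<close>
  obtain k where n: "n = Suc (Suc k)" using assms(2) by (metis add_Suc le_Suc_ex numeral_2_eq_2)
  let ?m = "Suc k"
  have x: "x \<in> cd_carrier n" and comm: "\<And>y. y \<in> cd_carrier n \<Longrightarrow> cd_mult g n x y = cd_mult g n y x"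
    using assms(4) by (auto simp: cd_center_def)
  obtain a b where ab: "x = Dbl a b" "a \<in> cd_carrier ?m" "b \<in> cd_carrier ?m"
    using x unfolding n by (rule cd_carrier_SucE)
  \<comment> \<open>With \<open>y = (0, 1)\<close>, the product \<open>x y\<close> is
    \<open>(g b, a)\<close> and \<open>y x\<close> is \<open>(g (cnj b), cnj a)\<close>.\<close>
  have "cd_smult (g ?m) b = cd_smult (g ?m) (cd_cnj b)" "cd_cnj a = a"
    using comm[of "Dbl (cd_zero ?m) (cd_one ?m)"] ab
    by (simp_all add: n cd_mult_zero cd_mult_one cd_cnj_zero del: cd_one.simps cd_zero.simps cd_mult.simps(2)
          add: cd_mult.simps(2)[where k = ?m])
  moreover have "g ?m \<noteq> 0" using assms(3) n by simp
  ultimately have "cd_cnj a = a" "cd_cnj b = b"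
    by (simp_all add: cd_smult_left_cancel)
  then obtain r s where rs: "a = cd_smult r (cd_one ?m)" "b = cd_smult s (cd_one ?m)"
    using ab assms(1) by (metis cd_cnj_eq_self_imp_scalar)
  let ?c = "Dbl (cd_zero k) (cd_one k) :: 'f cd"
  \<comment> \<open>These are the second components of \<open>x (c, 0)\<close> and
    \<open>(c, 0) x\<close>.\<close>
  have "cd_mult g ?m b (cd_cnj ?c) = cd_mult g ?m b ?c"
    using comm[of "Dbl ?c (cd_zero ?m)"] ab
    by (simp add: n cd_mult_zero cd_cnj_zero del: cd_one.simps cd_zero.simps cd_mult.simps(2) cd_cnj.simps
          add: cd_mult.simps(2)[where k = ?m] cd_cnj.simps(2)[of "Dbl _ _"])
  then have "cd_smult s (cd_cnj ?c) = cd_smult s ?c"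
    by (simp add: rs cd_mult_smult cd_mult_one del: cd_one.simps cd_mult.simps cd_cnj.simps)
  \<comment> \<open>Since \<open>cnj c = - c\<close>, comparing second components leaves
    \<open>- s = s\<close>.\<close>
  then have "cd_uminus (cd_smult s (cd_one k)) = cd_smult s (cd_one k)"
    by (simp add: cd_uminus_def mult.commute)
  then have "s = 0"
    using cd_uminus_eq_self_imp_zero[OF assms(1), of "cd_smult s (cd_one k)" k]
    by (simp add: cd_smult_one_eq_zero_iff)
  then have "x = cd_smult r (cd_one n)"
    using ab rs by (simp add: n)
  then show ?thesis by (auto simp: cd_scalars_def)
qed

section \<open>Imaginary parts\<close>

lemma cd_Im_closed [simp]: "x \<in> cd_carrier n \<Longrightarrow> cd_Im x \<in> cd_carrier n"
  by (simp add: cd_Im_def cd_diff_def)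

lemma cd_cnj_Im:
  assumes "x \<in> cd_carrier n"
  shows "cd_cnj (cd_Im x) = cd_smult (-1) (cd_Im x)"
  using assms
  by (simp add: cd_Im_def cd_diff_def cd_uminus_def cd_cnj_smult cd_cnj_add[where n = n]
      cd_smult_add_right[where n = n] cd_add_comm[where n = n])

lemma cd_half_diff_add_half_sum:
  assumes "(2::'f::field) \<noteq> 0" "x \<in> cd_carrier n" "y \<in> cd_carrier n"
  shows "cd_add (cd_smult (1 / 2) (cd_diff x y)) (cd_smult (1 / 2) (cd_add x y)) = (x :: 'f cd)"
  using assms(2,3)
proof (induction n arbitrary: x y)
  case 0
  then show ?case using assms(1) by (auto simp: cd_diff_def cd_uminus_def field_simps)
next
  case (Suc n)
  then show ?case by (auto elim!: cd_carrier_SucE simp: cd_diff_def cd_uminus_def)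
qed

text \<open>The remainder is half of \<open>x + cnj x\<close>, which the involution fixes.\<close>

lemma cd_Im_add_scalar:
  fixes x :: "'f::field cd"
  assumes "(2::'f) \<noteq> 0" "x \<in> cd_carrier n"
  obtains r where "x = cd_add (cd_Im x) (cd_smult r (cd_one n))"
proof -
  let ?s = "cd_smult (1 / 2) (cd_add x (cd_cnj x))"
  have "cd_cnj ?s = ?s"
    using assms(2) by (simp add: cd_cnj_smult cd_cnj_add[where n = n] cd_add_comm[where n = n])
  then obtain r where r: "?s = cd_smult r (cd_one n)"
    using assms by (metis cd_cnj_eq_self_imp_scalar cd_closed_linear(1,2) cd_cnj_closed)
  show thesis
    using cd_half_diff_add_half_sum[OF assms cd_cnj_closed[OF assms(2)]] that[of r]
    unfolding r cd_Im_def by simp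
qed

section \<open>Representatives of a vertex\<close>

lemma cd_center_add:
  assumes "x \<in> cd_center g n" "y \<in> cd_center g n"
  shows "cd_add x y \<in> cd_center g n"
  using assms by (simp add: cd_center_def cd_mult_add)

lemma cd_center_smult: "x \<in> cd_center g n \<Longrightarrow> cd_smult r x \<in> cd_center g n"
  by (simp add: cd_center_def cd_mult_smult)

lemma cd_vertex_subset:
  assumes "a \<in> cd_carrier n" "b \<in> cd_vertex g n a"
  shows "cd_vertex g n b \<subseteq> cd_vertex g n a"
proof
  fix c assume "c \<in> cd_vertex g n b"
  then obtain s w where c: "c = cd_add (cd_smult s b) w" and w: "w \<in> cd_center g n"
    by (auto simp: cd_vertex_def)
  obtain r z where b: "b = cd_add (cd_smult r a) z" and z: "z \<in> cd_center g n"
    using assms(2) by (auto simp: cd_vertex_def)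
  have "z \<in> cd_carrier n" "w \<in> cd_carrier n" using z w by (auto simp: cd_center_def)
  then have "c = cd_add (cd_smult (s * r) a) (cd_add (cd_smult s z) w)"
    using assms(1) by (simp add: b c cd_smult_add_right[where n = n] cd_add_assoc[where n = n])
  then show "c \<in> cd_vertex g n a"
    unfolding cd_vertex_def using cd_center_add[OF cd_center_smult[OF z] w] by blast
qed

text \<open>A noncentral \<open>b = r a + z\<close> has \<open>r\<close> nonzero, so
  \<open>a\<close> can be recovered from \<open>b\<close> modulo the center and the inclusion of
  vertices holds both ways.\<close>

lemma cd_vertex_eqI:
  assumes "a \<in> cd_carrier n" "b \<in> cd_vertex g n a" "b \<notin> cd_center g n"
  shows "cd_vertex g n b = cd_vertex g n a"
proof -
  obtain r z where b: "b = cd_add (cd_smult r a) z" and z: "z \<in> cd_center g n"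
    using assms(2) by (auto simp: cd_vertex_def)
  have zc: "z \<in> cd_carrier n" using z by (simp add: cd_center_def)
  have "r \<noteq> 0"
    using assms(1,3) b z zc by auto
  have "cd_smult (inverse r) b = cd_add a (cd_smult (inverse r) z)"
    using assms(1) zc \<open>r \<noteq> 0\<close> by (simp add: b cd_smult_add_right[where n = n])
  then have "a = cd_add (cd_smult (inverse r) b) (cd_smult (-1) (cd_smult (inverse r) z))"
    using assms(1) zc by (simp only: cd_add_uminus_cancel[where n = n] cd_closed_linear)
  then have "a \<in> cd_vertex g n b"
    unfolding cd_vertex_def using cd_center_smult[OF cd_center_smult[OF z]] by blast
  moreover have "b \<in> cd_carrier n" using b assms(1) zc by simp
  ultimately show ?thesis
    using assms cd_vertex_subset by blast
qed

lemma cd_Im_in_vertex: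
  fixes a :: "'f::field cd"
  assumes "(2::'f) \<noteq> 0" "a \<in> cd_carrier n"
  shows "cd_Im a \<in> cd_vertex g n a"
proof -
  obtain r where "a = cd_add (cd_Im a) (cd_smult r (cd_one n))"
    using assms by (rule cd_Im_add_scalar)
  then have "cd_Im a = cd_add (cd_smult 1 a) (cd_smult (-1) (cd_smult r (cd_one n)))"
    using assms(2) by (metis cd_Im_closed cd_add_uminus_cancel cd_closed_linear(1) cd_one_closed cd_smult_one)
  then show ?thesis
    unfolding cd_vertex_def using cd_center_smult[OF cd_scalar_in_center] by blast
qed

text \<open>Used contrapositively: the imaginary part of a noncentral element is noncentral and thus
  represents the same vertex.\<close>

lemma cd_Im_central_imp_central:
  fixes a :: "'f::field cd"
  assumes "(2::'f) \<noteq> 0" "a \<in> cd_carrier n" "cd_Im a \<in> cd_center g n"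
  shows "a \<in> cd_center g n"
  using cd_Im_add_scalar[OF assms(1,2)] cd_center_add[OF assms(3) cd_scalar_in_center] by metis

section \<open>Commuting elements and isolated vertices\<close>

lemma cd_commuting_imaginary_proportional:
  fixes g :: "nat \<Rightarrow> 'f::field"
  assumes two: "(2::'f) \<noteq> 0"
    and p: "p \<in> cd_carrier n" "cd_cnj p = cd_smult (-1) p" "p \<noteq> cd_zero n" "p \<notin> cd_zero_divisors g n"
    and q: "q \<in> cd_carrier n" "cd_cnj q = cd_smult (-1) q"
    and comm: "cd_mult g n p q = cd_mult g n q p"
  obtains \<mu> where "q = cd_smult \<mu> p"
proof -
  \<comment> \<open>The involution turns \<open>p q\<close> into \<open>(- q) (- p) = q p\<close>,
    which is \<open>p q\<close> by commutativity.\<close>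
  have "cd_cnj (cd_mult g n p q) = cd_mult g n p q"
    using p q comm by (simp add: cd_cnj_mult cd_mult_smult)
  then obtain l where l: "cd_mult g n p q = cd_smult l (cd_one n)"
    using two p q by (metis cd_cnj_eq_self_imp_scalar cd_mult_closed)
  have "cd_cnj (cd_mult g n p p) = cd_mult g n p p"
    using p by (simp add: cd_cnj_mult cd_mult_smult)
  then obtain m where m: "cd_mult g n p p = cd_smult m (cd_one n)"
    using two p by (metis cd_cnj_eq_self_imp_scalar cd_mult_closed)
  \<comment> \<open>Otherwise \<open>p\<close> itself would witness that \<open>p\<close> is a zero
    divisor.\<close>
  have "m \<noteq> 0"
    using p m by (auto simp: cd_zero_divisors_def cd_smult_one_eq_zero_iff)
  \<comment> \<open>The coefficient \<open>l / m\<close> is chosen so that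
    \<open>p (q - (l / m) p) = l - (l / m) m = 0\<close>.\<close>
  let ?c = "cd_add q (cd_smult (-1) (cd_smult (l / m) p))"
  have "cd_mult g n p ?c = cd_zero n"
    using p q \<open>m \<noteq> 0\<close> cd_smult_add_left[of l "- l" "cd_one n", symmetric]
    by (simp add: cd_mult_add cd_mult_smult l m)
  moreover have "?c \<in> cd_carrier n"
    using p q by simp
  ultimately have "?c = cd_zero n"
    using p unfolding cd_zero_divisors_def by blast
  then have "cd_add (cd_smult (-1) (cd_smult (l / m) p)) q
      = cd_add (cd_smult (-1) (cd_smult (l / m) p)) (cd_smult (l / m) p)"
    using p q by (metis cd_add_comm cd_add_uminus_right cd_closed_linear(1))
  then have "q = cd_smult (l / m) p"
    using p q by (simp only: cd_add_left_cancel[where n = n] cd_closed_linear)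
  then show thesis by (rule that)
qed

text \<open>Passing to imaginary parts changes neither the vertices nor the commutation, and
  proportional noncentral elements represent one vertex.\<close>

lemma cd_commuting_vertex_eq:
  fixes g :: "nat \<Rightarrow> 'f::field"
  assumes two: "(2::'f) \<noteq> 0"
    and a: "a \<in> cd_carrier n - cd_center g n" "cd_Im a \<notin> cd_zero_divisors g n"
    and b: "b \<in> cd_carrier n - cd_center g n"
    and comm: "cd_mult g n a b = cd_mult g n b a"
  shows "cd_vertex g n b = cd_vertex g n a"
proof -
  let ?p = "cd_Im a" and ?q = "cd_Im b"
  have p: "?p \<in> cd_vertex g n a" "?p \<notin> cd_center g n"
    and q: "?q \<in> cd_vertex g n b" "?q \<notin> cd_center g n"
    using a b two cd_Im_in_vertex cd_Im_central_imp_central by blast+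
  \<comment> \<open>Commutation survives replacing a factor by another member of its vertex; the two
    factors are replaced one after the other.\<close>
  have "cd_mult g n ?p b = cd_mult g n b ?p"
    using cd_commute_vertex[OF _ _ p(1) comm] a b by blast
  then have "cd_mult g n ?p ?q = cd_mult g n ?q ?p"
    using cd_commute_vertex[OF _ _ q(1)] a b by (metis DiffD1 cd_Im_closed)
  moreover have "?p \<noteq> cd_zero n" using p(2) cd_center_zero by metis
  ultimately obtain \<mu> where "?q = cd_smult \<mu> ?p"
    using cd_commuting_imaginary_proportional[OF two, of ?p n g ?q] a b cd_cnj_Im cd_Im_closed
    by (metis DiffD1)
  then have "?q = cd_add (cd_smult \<mu> ?p) (cd_zero n)"
    using a by simp
  then have "?q \<in> cd_vertex g n ?p"
    unfolding cd_vertex_def using cd_center_zero by blast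
  then have "cd_vertex g n ?q = cd_vertex g n ?p"
    using cd_vertex_eqI q(2) a by (metis DiffD1 cd_Im_closed)
  then show ?thesis
    using cd_vertex_eqI[OF _ p] cd_vertex_eqI[OF _ q] a b by simp
qed

theorem corollary4p4:
  fixes \<gamma> :: "nat \<Rightarrow> 'f::field" and n :: nat and a :: "'f cd"
  assumes "CHAR('f) \<noteq> 2"
    and "n \<ge> 2"
    and "\<forall>i<n. \<gamma> i \<noteq> 0"
    and "cd_anisotropic \<gamma> n"
    and "a \<in> cd_carrier n - cd_scalars n"
    and "cd_Im a \<notin> cd_zero_divisors \<gamma> n"
  shows "graph_component (comm_graph_verts \<gamma> n) (comm_graph_adj \<gamma> n) (cd_vertex \<gamma> n a)
           = {cd_vertex \<gamma> n a}"
proof -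
  let ?v = "cd_vertex \<gamma> n a"
  let ?E = "{(x, y). x \<in> comm_graph_verts \<gamma> n \<and> y \<in> comm_graph_verts \<gamma> n \<and> comm_graph_adj \<gamma> n x y}"
  have two: "(2::'f) \<noteq> 0"
    using assms(1) by (rule two_neq_zero_if_CHAR_neq_2)
  have a: "a \<in> cd_carrier n - cd_center \<gamma> n"
    using cd_center_scalar[OF two assms(2,3)] assms(5) by blast
  have isolated: "(?v, w) \<notin> ?E" for w
  proof
    assume "(?v, w) \<in> ?E"
    then obtain b where b: "b \<in> cd_carrier n - cd_center \<gamma> n" and w: "w = cd_vertex \<gamma> n b"
      and "comm_graph_adj \<gamma> n ?v w"
      by (auto simp: comm_graph_verts_def)
    then have "cd_vertex \<gamma> n b \<noteq> ?v" "cd_mult \<gamma> n a b = cd_mult \<gamma> n b a"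
      using comm_graph_adj_iff[OF a b] by auto
    then show False
      using cd_commuting_vertex_eq[OF two a assms(6) b] by simp
  qed
  \<comment> \<open>A nonempty path from \<open>?v\<close> would begin with an edge at
    \<open>?v\<close>, and there is none.\<close>
  have "w = ?v" if "(?v, w) \<in> ?E\<^sup>*" for w
    using that isolated by (auto elim: converse_rtranclE)
  moreover have "?v \<in> comm_graph_verts \<gamma> n"
    using a by (auto simp: comm_graph_verts_def)
  ultimately show ?thesis
    by (auto simp: graph_component_def)
qed

end
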